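(* There are absolute constants $c>0$ and $c'>0$ such that for every integer $n\ge 3$ and every real $\epsilon$ with $\frac1n \le \epsilon \le \frac{1}{\log_2 n}$, there exists an $\epsilon$-distance-uniform graph on $n$ vertices whose critical distance $d$ satisfies \[ d \ge c'\, 2^{c\,\frac{\log n}{\log \epsilon^{-1}}}. \] (In the paper's notation: $d = 2^{\Omega\left(\frac{\log n}{\log \epsilon^{-1}}\right)}$.)
   Context: For a parameter $\epsilon>0$, an $n$-vertex graph $G$ is called $\epsilon$-distance-uniform if there is a value $d$, called the critical distance, such that for every vertex $v$, all but at most $\epsilon n$ of the other vertices are at graph distance exactly $d$ from $v$. The ratio $\frac{\log n}{\log \epsilon^{-1}}$ does not depend on the base of the logarithm. *)

theory Defs
  imports Complex_Main
begin

definition simple_graph :: "nat \<Rightarrow> (nat \<Rightarrow> nat \<Rightarrow> bool) \<Rightarrow> bool" where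
  "simple_graph n E \<longleftrightarrow>
     (\<forall>u v. E u v \<longrightarrow> u < n \<and> v < n) \<and>
     (\<forall>u v. E u v \<longrightarrow> E v u) \<and> (\<forall>u. \<not> E u u)"

definition walk_of_length :: "(nat \<Rightarrow> nat \<Rightarrow> bool) \<Rightarrow> nat \<Rightarrow> nat \<Rightarrow> nat \<Rightarrow> bool" where
  "walk_of_length E u v k \<longleftrightarrow>
     (\<exists>xs. length xs = Suc k \<and> xs ! 0 = u \<and> xs ! k = v \<and>
           (\<forall>i<k. E (xs ! i) (xs ! Suc i)))"

text \<open>Graph distance between u and v is exactly d (disconnected pairs have no finite distance).\<close>
definition graph_dist_eq :: "(nat \<Rightarrow> nat \<Rightarrow> bool) \<Rightarrow> nat \<Rightarrow> nat \<Rightarrow> nat \<Rightarrow> bool" where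
  "graph_dist_eq E u v d \<longleftrightarrow> walk_of_length E u v d \<and> (\<forall>k<d. \<not> walk_of_length E u v k)"

definition distance_uniform :: "nat \<Rightarrow> (nat \<Rightarrow> nat \<Rightarrow> bool) \<Rightarrow> real \<Rightarrow> nat \<Rightarrow> bool" where
  "distance_uniform n E eps d \<longleftrightarrow>
     (\<forall>v<n. real (card {u. u < n \<and> u \<noteq> v \<and> \<not> graph_dist_eq E v u d}) \<le> eps * real n)"

end

theory Submission
  imports Defs
begin

text \<open>
  The graphs come from a variant of the Tower of Hanoi. A state is a word of length \<open>k\<close> without equal
  neighbouring letters; a move picks a suffix that alternates between two letters \<open>a\<close>, \<open>b\<close>, both
  different from the letter in front of it, and exchanges \<open>a\<close> and \<open>b\<close>. To change the first letter
  from \<open>a\<close> to \<open>b\<close> the rest of the word must first become \<open>b a b a \<dots>\<close>, and afterwards it has to be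
  rebuilt from \<open>a b a b \<dots>\<close>; so at most \<open>2 ^ k - 1\<close> moves join any two words, and for words without
  common letters there is no shortcut. Over an alphabet much larger than \<open>k\<^sup>2\<close>, almost all words have no
  letter in common with a given one. Blowing up every vertex to a class of almost equal size gives
  all orders \<open>n\<close>.
\<close>

section \<open>Words and moves\<close>

fun alt :: "nat \<Rightarrow> 'a \<Rightarrow> 'a \<Rightarrow> 'a list" where
  "alt 0 a b = []"
| "alt (Suc k) a b = a # alt k b a"

text \<open>The parameter \<open>p\<close> is the letter in front of the word.\<close>

fun valid :: "'a \<Rightarrow> 'a list \<Rightarrow> bool" where
  "valid p [] \<longleftrightarrow> True"
| "valid p (x # xs) \<longleftrightarrow> x \<noteq> p \<and> valid x xs"

text \<open>For words of length one the alternating rests are empty, so that the last letter can be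
  changed freely.\<close>

fun move :: "'a \<Rightarrow> 'a list \<Rightarrow> 'a list \<Rightarrow> bool" where
  "move p (x # xs) (y # ys) \<longleftrightarrow> x \<noteq> p \<and> y \<noteq> p \<and>
     (if x = y then move x xs ys
      else (\<exists>k. xs = alt k y x \<and> ys = alt k x y))"
| "move p _ _ \<longleftrightarrow> False"

lemma length_alt [simp]: "length (alt k a b) = k"
  by (induction k arbitrary: a b) auto

lemma set_alt: "set (alt k a b) \<subseteq> {a, b}"
  by (induction k arbitrary: a b) auto

lemma valid_alt: "a \<noteq> b \<Longrightarrow> a \<noteq> p \<Longrightarrow> valid p (alt k a b)"
  by (induction k arbitrary: a b p) auto

lemma move_sym: "move p xs ys \<Longrightarrow> move p ys xs"
  by (induction p xs ys rule: move.induct) (auto split: if_splits)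

lemma move_irrefl: "\<not> move p xs xs"
  by (induction xs arbitrary: p) auto

lemma move_length: "move p xs ys \<Longrightarrow> length xs = length ys"
  by (induction p xs ys rule: move.induct) (auto split: if_splits)

lemma walk_sym: "(move p ^^ m) xs ys \<Longrightarrow> (move p ^^ m) ys xs"
proof (induction m arbitrary: ys)
  case (Suc m)
  then obtain zs where "(move p ^^ m) xs zs" "move p zs ys" by auto
  with Suc.IH show ?case by (metis move_sym relpowp_Suc_I2)
qed auto

section \<open>Lower bound on the length of walks\<close>

text \<open>The walk is cut at its first move that changes the first letter, say to
  \<open>z\<close>. Before it only the rest moves, with \<open>x\<close> in front; the move itself
  forces the rest to be \<open>z x z ...\<close> before and \<open>x z x ...\<close> after. The
  letter \<open>z\<close> may differ from \<open>y\<close>.\<close>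

lemma walk_first_change:
  assumes "(move p ^^ m) (x # xs) (y # ys)"
  shows "x = y \<and> (move x ^^ m) xs ys \<or>
    (\<exists>z m1 m2. m = m1 + 1 + m2 \<and> x \<noteq> p \<and> z \<noteq> x \<and> z \<noteq> p \<and>
       (move x ^^ m1) xs (alt (length xs) z x) \<and>
       (move p ^^ m2) (z # alt (length xs) x z) (y # ys))"
  using assms
proof (induction m arbitrary: xs)
  case (Suc m)
  then obtain w where w: "move p (x # xs) w" "(move p ^^ m) w (y # ys)"
    by (meson relpowp_Suc_D2)
  then obtain z zs where [simp]: "w = z # zs"
    by (cases w) auto
  show ?case
  proof (cases "z = x")
    case True
    with w have step: "move x xs zs" and len: "length xs = length zs"
      by (auto dest: move_length)
    from Suc.IH[of zs] w True consider "x = y" "(move x ^^ m) zs ys"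
      | z m1 m2 where "m = m1 + 1 + m2" "x \<noteq> p" "z \<noteq> x" "z \<noteq> p"
          "(move x ^^ m1) zs (alt (length zs) z x)"
          "(move p ^^ m2) (z # alt (length zs) x z) (y # ys)"
      by auto
    then show ?thesis
    proof cases
      case 1
      with step show ?thesis by (meson relpowp_Suc_I2)
    next
      case 2
      have "(move x ^^ Suc m1) xs (alt (length xs) z x)"
        using 2 step len by (metis relpowp_Suc_I2)
      then show ?thesis
        using 2 len by (intro disjI2 exI[of _ z] exI[of _ "Suc m1"] exI[of _ m2]) auto
    qed
  next
    case False
    with w obtain k where "x \<noteq> p" "z \<noteq> p" "xs = alt k z x" "zs = alt k x z"
      by (auto split: if_splits)
    with w False show ?thesis
      by (intro disjI2 exI[of _ z] exI[of _ 0] exI[of _ m]) auto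
  qed
qed auto

text \<open>The rest of a word must reach \<open>alt k a p\<close> before a letter \<open>p\<close>
  in front of it can become \<open>a\<close>. A named predicate lets \<open>alt_source_bound\<close>
  assume the bound at a single length, as the induction on \<open>k\<close> requires; the type token
  fixes the type of letters, which \<open>k\<close> does not determine.\<close>

definition alt_target_bound :: "nat \<Rightarrow> 'a itself \<Rightarrow> bool" where
  "alt_target_bound k _ \<longleftrightarrow> (\<forall>p a m. \<forall>xs :: 'a list. length xs = k \<longrightarrow> a \<noteq> p \<longrightarrow> a \<notin> set xs \<longrightarrow>
     (move p ^^ m) xs (alt k a p) \<longrightarrow> 2 ^ k \<le> m + 1)"

lemma alt_target_boundD:
  assumes "alt_target_bound k TYPE('a)" "(move p ^^ m) xs (alt k a p)"
    "length xs = k" "(a :: 'a) \<noteq> p" "a \<notin> set xs"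
  shows "2 ^ k \<le> m + 1"
  using assms by (auto simp: alt_target_bound_def)

text \<open>If the first letter never changes, \<open>x\<close> is \<open>v\<close> and the reversed
  walk builds \<open>alt k v u\<close> from \<open>ys\<close>, which lacks \<open>v\<close>. If it
  first changes to \<open>v\<close>, the new word has the same form with \<open>u\<close> and
  \<open>v\<close> exchanged, and a shorter walk remains. If it changes to a third letter
  \<open>w\<close>, the rest must already have become \<open>alt k w u\<close> from a word without
  \<open>w\<close>.\<close>

lemma alt_source_bound:
  fixes u v x y :: 'a
  assumes F: "alt_target_bound k TYPE('a)"
  assumes "(move p ^^ m) (u # alt k v u) (y # ys)"
    "length ys = k" "u \<noteq> v" "x \<in> {u, v}" "x \<notin> set (y # ys)"
  shows "2 ^ k \<le> m + 1"
  using assms(2-)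
proof (induction m arbitrary: u v rule: less_induct)
  case (less m)
  from walk_first_change[OF less.prems(1)] consider "u = y" "(move u ^^ m) (alt k v u) ys"
    | w m1 m2 where "m = m1 + 1 + m2" "u \<noteq> p" "w \<noteq> u" "w \<noteq> p"
        "(move u ^^ m1) (alt k v u) (alt k w u)" "(move p ^^ m2) (w # alt k u w) (y # ys)"
    by auto
  then show ?case
  proof cases
    case 1
    with less.prems have "x = v" by auto
    with 1 less.prems show ?thesis
      by (intro alt_target_boundD[OF F walk_sym[OF 1(2)]]) auto
  next
    case 2
    show ?thesis
    proof (cases "w = v")
      case True
      then show ?thesis
        using less.IH[of m2 w u] 2 less.prems by auto
    next
      case False
      have "2 ^ k \<le> m1 + 1"
        using 2 False set_alt[of k v u] by (intro alt_target_boundD[OF F 2(5)]) auto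
      with 2 show ?thesis by simp
    qed
  qed
qed

text \<open>Consider the first change of the first letter. If the new letter is \<open>a\<close>,
  both the approach to \<open>alt k a x\<close> and the rebuilding afterwards take at least
  \<open>2 ^ k - 1\<close> moves. Otherwise the word reached still lacks \<open>a\<close>, and
  induction covers the shorter remaining walk.\<close>

lemma alt_target_bound: "alt_target_bound k TYPE('a)"
proof (induction k)
  case 0
  show ?case by (simp add: alt_target_bound_def)
next
  case (Suc k)
  have "2 ^ Suc k \<le> m + 1"
    if "(move p ^^ m) (x # xs) (a # alt k p a)" "length xs = k" "a \<noteq> p" "a \<notin> set (x # xs)"
    for p a x :: 'a and xs m
    using that
  proof (induction m arbitrary: x xs rule: less_induct)
    case (less m)
    with walk_first_change[OF less.prems(1)] obtain z m1 m2 where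
      z: "m = m1 + 1 + m2" "x \<noteq> p" "z \<noteq> x" "z \<noteq> p"
        "(move x ^^ m1) xs (alt k z x)" "(move p ^^ m2) (z # alt k x z) (a # alt k p a)"
      by auto
    show ?case
    proof (cases "z = a")
      case True
      have "2 ^ k \<le> m1 + 1"
        using z True less.prems by (intro alt_target_boundD[OF Suc.IH z(5)]) auto
      \<comment> \<open>The letter \<open>x\<close> differs from \<open>p\<close>, since it stood
        behind \<open>p\<close> when it was changed, and from \<open>a\<close>; hence the target
        lacks \<open>x\<close>.\<close>
      moreover have "2 ^ k \<le> m2 + 1"
        using z True less.prems set_alt[of k p a]
        by (intro alt_source_bound[OF Suc.IH z(6), of x]) auto
      ultimately show ?thesis using z by simp
    next
      case False
      then have "2 ^ Suc k \<le> m2 + 1"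
        using z less.prems set_alt[of k x z] by (intro less.IH[OF _ z(6)]) auto
      then show ?thesis using z by simp
    qed
  qed
  then show ?case
    unfolding alt_target_bound_def by (auto simp: length_Suc_conv)
qed

text \<open>The argument of \<open>alt_target_bound\<close> again, now asking whether the new first
  letter \<open>z\<close> occurs anywhere in the target. If so, \<open>xs\<close> lacks
  \<open>z\<close> and the target lacks \<open>x\<close>, so both halves are long; if not, the new
  word is again disjoint from the target.\<close>

lemma disjoint_walk_bound:
  assumes "(move p ^^ m) xs ys" "length xs = k" "length ys = k" "set xs \<inter> set ys = {}"
  shows "2 ^ k \<le> m + 1"
proof (cases k)
  case (Suc k')
  have "2 ^ Suc k' \<le> m + 1"
    if "(move p ^^ m) (x # xs) (y # ys)" "length xs = k'" "length ys = k'"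
      "set (x # xs) \<inter> set (y # ys) = {}" for x y :: 'a and xs ys m
    using that
  proof (induction m arbitrary: x xs rule: less_induct)
    case (less m)
    with walk_first_change[OF less.prems(1)] obtain z m1 m2 where
      z: "m = m1 + 1 + m2" "x \<noteq> p" "z \<noteq> x" "z \<noteq> p"
        "(move x ^^ m1) xs (alt k' z x)" "(move p ^^ m2) (z # alt k' x z) (y # ys)"
      by auto
    show ?case
    proof (cases "z \<in> set (y # ys)")
      case True
      have "2 ^ k' \<le> m1 + 1"
        using z True less.prems by (intro alt_target_boundD[OF alt_target_bound z(5)]) auto
      moreover have "2 ^ k' \<le> m2 + 1"
        using z less.prems by (intro alt_source_bound[OF alt_target_bound z(6), of x]) auto
      ultimately show ?thesis using z by simp
    next
      case False
      then have "2 ^ Suc k' \<le> m2 + 1"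
        using z less.prems set_alt[of k' x z] by (intro less.IH[OF _ z(6)]) auto
      then show ?thesis using z by simp
    qed
  qed
  with assms Suc show ?thesis by (auto simp: length_Suc_conv)
qed (use assms in auto)

section \<open>Short walks\<close>

text \<open>Vertices of the graph will be valid words over a finite alphabet, so the upper bound
  needs walks that stay among them. The lower bound covers all moves.\<close>

abbreviation move_in :: "'a set \<Rightarrow> 'a \<Rightarrow> 'a list \<Rightarrow> 'a list \<Rightarrow> bool" where
  "move_in A p xs ys \<equiv> move p xs ys \<and> set xs \<subseteq> A \<and> set ys \<subseteq> A \<and> valid p xs \<and> valid p ys"

lemma move_in_walk_Cons:
  assumes "(move_in A x ^^ m) xs ys" "x \<in> A" "x \<noteq> p"
  shows "(move_in A p ^^ m) (x # xs) (x # ys)"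
  using assms(1)
proof (induction m arbitrary: ys)
  case (Suc m)
  then obtain zs where "(move_in A x ^^ m) xs zs" "move_in A x zs ys"
    by (auto elim!: relpowp_Suc_E)
  with Suc.IH[of zs] assms(2,3) show ?case
    by (intro relpowp_Suc_I[of _ _ _ "x # zs"]) auto
qed auto

text \<open>The recursive Hanoi strategy: bring the rest to \<open>alt k y x\<close>, make one
  exchanging move, rebuild the rest; \<open>2 * (2 ^ k - 1) + 1\<close> moves suffice.\<close>

lemma short_walk:
  assumes "length xs = k" "length ys = k" "valid p xs" "valid p ys" "set xs \<subseteq> A" "set ys \<subseteq> A"
  shows "\<exists>m. m + 1 \<le> 2 ^ k \<and> (move_in A p ^^ m) xs ys"
  using assms
proof (induction k arbitrary: p xs ys)
  case 0
  then show ?case by (intro exI[of _ 0]) auto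
next
  case (Suc k)
  then obtain x xs' y ys' where [simp]: "xs = x # xs'" "ys = y # ys'"
    by (metis length_Suc_conv)
  show ?case
  proof (cases "x = y")
    case True
    then obtain m where m: "m + 1 \<le> 2 ^ k" "(move_in A x ^^ m) xs' ys'"
      using Suc.IH[of xs' ys' x] Suc.prems by auto
    with move_in_walk_Cons[OF m(2), of p] True Suc.prems show ?thesis
      by (intro exI[of _ m]) auto
  next
    case False
    let ?u = "alt k y x" and ?v = "alt k x y"
    have uv: "valid x ?u" "valid y ?v" "set ?u \<subseteq> A" "set ?v \<subseteq> A"
      using False Suc.prems set_alt[of k x y] set_alt[of k y x] by (auto intro!: valid_alt)
    obtain m1 where m1: "m1 + 1 \<le> 2 ^ k" "(move_in A x ^^ m1) xs' ?u"
      using Suc.IH[of xs' ?u x] Suc.prems uv by auto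
    obtain m2 where m2: "m2 + 1 \<le> 2 ^ k" "(move_in A y ^^ m2) ?v ys'"
      using Suc.IH[of ?v ys' y] Suc.prems uv by auto
    have walks: "(move_in A p ^^ m1) xs (x # ?u)" "(move_in A p ^^ m2) (y # ?v) ys"
      using move_in_walk_Cons[OF m1(2), of p] move_in_walk_Cons[OF m2(2), of p] Suc.prems by auto
    have "move_in A p (x # ?u) (y # ?v)"
      using False Suc.prems uv by auto
    then have "(move_in A p ^^ (Suc m1 + m2)) xs ys"
      by (rule relpowp_trans[OF relpowp_Suc_I[OF walks(1)] walks(2)])
    with m1 m2 show ?thesis
      by (intro exI[of _ "Suc m1 + m2"]) auto
  qed
qed

section \<open>Counting words\<close>

definition words :: "'a set \<Rightarrow> 'a \<Rightarrow> nat \<Rightarrow> 'a list set" where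
  "words A p k = {xs. length xs = k \<and> set xs \<subseteq> A \<and> valid p xs}"

lemma words_Suc: "words A p (Suc k) = (\<Union>x\<in>A - {p}. (#) x ` words A x k)"
  by (auto simp: words_def length_Suc_conv)

lemma finite_words: "finite A \<Longrightarrow> finite (words A p k)"
  by (induction k arbitrary: p) (auto simp: words_Suc, simp add: words_def)

lemma card_words_Suc:
  assumes "finite A"
  shows "card (words A p (Suc k)) = (\<Sum>x\<in>A - {p}. card (words A x k))"
  unfolding words_Suc using assms
  by (subst card_UN_disjoint) (auto simp: finite_words card_image)

lemma words_0 [simp]: "words A p 0 = {[]}"
  by (auto simp: words_def)

lemma card_words:
  assumes "finite A" "p \<in> A"
  shows "card (words A p k) = (card A - 1) ^ k"
  using assms(2) by (induction k arbitrary: p) (simp_all add: card_words_Suc assms(1))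

text \<open>Here \<open>p\<close> may lie outside the alphabet, as can happen for
  \<open>A - set xs\<close>; the first letter then has one more choice.\<close>

lemma card_words_ge:
  assumes "finite A"
  shows "(card A - 1) ^ k \<le> card (words A p k)"
proof (induction k arbitrary: p)
  case (Suc k)
  have "(card A - 1) ^ Suc k \<le> card (A - {p}) * (card A - 1) ^ k"
    using assms by (simp add: card_Diff_singleton_if)
  also have "\<dots> \<le> card (words A p (Suc k))"
    unfolding card_words_Suc[OF assms]
    using sum_bounded_below[of "A - {p}" "(card A - 1) ^ k" "\<lambda>x. card (words A x k)"] Suc.IH by simp
  finally show ?case .
qed simp

text \<open>The words avoiding \<open>xs\<close> are words over \<open>A - set xs\<close>, at least
  \<open>(q - k) ^ k\<close> of the \<open>q ^ k\<close>. By Bernoulli's inequality this is at least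
  the fraction \<open>1 - k ^ 2 / q\<close>.\<close>

lemma card_meeting_words:
  assumes "finite A" "p \<in> A" "card A = Suc q" "k \<le> q" "0 < q" "length xs = k"
  shows "real (card {ys \<in> words A p k. set xs \<inter> set ys \<noteq> {}}) * real q \<le> real k ^ 2 * real q ^ k"
proof -
  let ?B = "{ys \<in> words A p k. set xs \<inter> set ys \<noteq> {}}"
  have fin: "finite (words A p k)" using assms by (simp add: finite_words)
  have "?B = words A p k - words (A - set xs) p k"
    by (auto simp: words_def)
  moreover have sub: "words (A - set xs) p k \<subseteq> words A p k"
    by (auto simp: words_def)
  ultimately have card: "card ?B = card (words A p k) - card (words (A - set xs) p k)"
    using fin by (simp add: card_Diff_subset finite_subset)
  have "Suc q - k \<le> card (A - set xs)"
    using assms diff_card_le_card_Diff[of "set xs" A] card_length[of xs] by simp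
  then have "(q - k) ^ k \<le> (card (A - set xs) - 1) ^ k"
    using assms(4) by (intro power_mono) auto
  also have "\<dots> \<le> card (words (A - set xs) p k)"
    using assms(1) by (intro card_words_ge) auto
  finally have "real (card ?B) \<le> real q ^ k - real ((q - k) ^ k)"
    using card card_mono[OF fin sub] card_words[OF assms(1,2), of k] assms(3) by (simp flip: of_nat_power)
  also have "\<dots> = real q ^ k * (1 - (1 + - (real k / real q)) ^ k)"
    using assms by (simp add: algebra_simps diff_divide_distrib flip: power_mult_distrib)
  also have "\<dots> \<le> real q ^ k * (real k * (real k / real q))"
    using Bernoulli_inequality[of "- (real k / real q)" k] assms
    by (intro mult_left_mono) auto
  finally show ?thesis
    using assms by (simp add: field_simps power2_eq_square)
qed

section \<open>Blowing up\<close>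

lemma walk_of_length_iff: "walk_of_length E u v k \<longleftrightarrow> (E ^^ k) u v"
proof
  assume "walk_of_length E u v k"
  then show "(E ^^ k) u v"
    unfolding walk_of_length_def relpowp_fun_conv by metis
next
  assume "(E ^^ k) u v"
  then obtain f where f: "f 0 = u" "f k = v" "\<forall>i<k. E (f i) (f (Suc i))"
    unfolding relpowp_fun_conv by blast
  then show "walk_of_length E u v k"
    unfolding walk_of_length_def by (intro exI[of _ "map f [0..<Suc k]"]) (auto simp: nth_append simp del: upt_Suc)
qed

lemma card_mod_le:
  assumes "finite I" "0 < N"
  shows "card {u. u < n \<and> u mod N \<in> I} \<le> (n div N + 1) * card I"
proof -
  have "card {u. u < n \<and> u mod N \<in> I} \<le> card ({..n div N} \<times> I)"
    using assms
    by (intro card_inj_on_le[of "\<lambda>u. (u div N, u mod N)"])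
      (auto simp: div_le_mono intro!: inj_onI, metis div_mult_mod_eq)
  then show ?thesis by (simp add: card_cartesian_product)
qed

text \<open>Vertex \<open>u\<close> carries the word numbered \<open>u mod N\<close>. Walks project
  to words and lift back, so vertices with disjoint words are at distance \<open>2 ^ k - 1\<close>;
  the remaining pairs are counted by \<open>card_meeting_words\<close>.\<close>

lemma hanoi_distance_uniform:
  assumes "1 \<le> k" "k \<le> q" "q ^ k \<le> n" "2 * real k ^ 2 \<le> eps * real q"
  shows "\<exists>E. simple_graph n E \<and> distance_uniform n E eps (2 ^ k - 1)"
proof -
  define A where "A = {..q}"
  define W where "W = words A 0 k"
  define N where "N = q ^ k"
  have q: "0 < q" and N: "0 < N" "N \<le> n" using assms by (auto simp: N_def)
  have A: "finite A" "0 \<in> A" "card A = Suc q" by (auto simp: A_def)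
  have W: "finite W" "card W = N"
    using A by (auto simp: W_def N_def finite_words card_words)
  then obtain h where h: "bij_betw h {0..<N} W"
    using ex_bij_betw_nat_finite by blast
  define f where "f u = h (u mod N)" for u
  have f_W: "f u \<in> W" for u
    using h N by (auto simp: f_def bij_betw_def)
  have f_surj: "\<exists>u<n. f u = w" if "w \<in> W" for w
  proof -
    from h that obtain u where "u < N" "h u = w" by (auto simp: bij_betw_def)
    with N show ?thesis by (intro exI[of _ u]) (auto simp: f_def)
  qed
  define E where "E u v \<longleftrightarrow> u < n \<and> v < n \<and> move 0 (f u) (f v)" for u v
  have project: "(move 0 ^^ m) (f u) (f v)" if "(E ^^ m) u v" for m u v
    using that
  proof (induction m arbitrary: v)
    case (Suc m)
    then obtain v' where "(E ^^ m) u v'" "E v' v" by auto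
    moreover from \<open>E v' v\<close> have "move 0 (f v') (f v)" by (simp add: E_def)
    ultimately show ?case using Suc.IH[of v'] by auto
  qed auto
  have lift: "\<exists>v<n. f v = w \<and> (E ^^ m) u v" if "(move_in A 0 ^^ m) (f u) w" "u < n" for m u w
    using that
  proof (induction m arbitrary: w)
    case (Suc m)
    then obtain w' where w': "(move_in A 0 ^^ m) (f u) w'" "move_in A 0 w' w"
      by (auto elim!: relpowp_Suc_E)
    with Suc obtain v' where v': "v' < n" "f v' = w'" "(E ^^ m) u v'" by blast
    have "w \<in> W"
      using w' v' f_W[of v'] move_length[of 0 w' w] by (auto simp: W_def words_def)
    then obtain v where "v < n" "f v = w" using f_surj by blast
    with v' w' have "E v' v" by (simp add: E_def)
    with v' \<open>v < n\<close> \<open>f v = w\<close> show ?case by auto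
  qed auto
  have dist: "graph_dist_eq E u v (2 ^ k - 1)"
    if "u < n" "v < n" "set (f u) \<inter> set (f v) = {}" for u v
  proof -
    have lower: "2 ^ k \<le> m + 1" if "(E ^^ m) u v" for m
      using disjoint_walk_bound[OF project[OF that], of k] f_W[of u] f_W[of v]
        \<open>set (f u) \<inter> set (f v) = {}\<close> by (auto simp: W_def words_def)
    obtain m where m: "m + 1 \<le> 2 ^ k" "(move_in A 0 ^^ m) (f u) (f v)"
      using short_walk[of "f u" k "f v" 0 A] f_W[of u] f_W[of v] by (auto simp: W_def words_def)
    \<comment> \<open>\<open>lift\<close> controls only the word at the end of a walk, not which
      vertex of its class is reached. So all moves but the last are lifted and the last is an edge
      straight to \<open>v\<close>, which requires a last move.\<close>
    have "m \<noteq> 0"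
    proof
      assume "m = 0"
      with m have "f u = f v" by simp
      with that f_W[of u] assms(1) show False by (auto simp: W_def words_def)
    qed
    then obtain m' where [simp]: "m = Suc m'" by (cases m) auto
    from m obtain w where w: "(move_in A 0 ^^ m') (f u) w" "move_in A 0 w (f v)"
      by (auto elim!: relpowp_Suc_E)
    then obtain v' where v': "v' < n" "f v' = w" "(E ^^ m') u v'"
      using lift \<open>u < n\<close> by blast
    then have "(E ^^ m) u v" using w that by (auto simp: E_def)
    moreover from lower[OF this] m have "m = 2 ^ k - 1" by simp
    moreover have "\<not> (E ^^ l) u v" if "l < 2 ^ k - 1" for l
      using lower[of l] that by auto
    ultimately show ?thesis
      unfolding graph_dist_eq_def walk_of_length_iff by metis
  qed
  have "simple_graph n E"
    by (auto simp: simple_graph_def E_def move_irrefl intro: move_sym)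
  moreover have "distance_uniform n E eps (2 ^ k - 1)"
    unfolding distance_uniform_def
  proof (intro allI impI)
    fix v assume "v < n"
    let ?B = "{w \<in> W. set (f v) \<inter> set w \<noteq> {}}"
    let ?I = "{i \<in> {0..<N}. h i \<in> ?B}"
    have "card ?I \<le> card ?B"
      using h W by (intro card_inj_on_le[of h]) (auto simp: bij_betw_def intro: inj_on_subset)
    have "card {u. u < n \<and> u \<noteq> v \<and> \<not> graph_dist_eq E v u (2 ^ k - 1)}
        \<le> card {u. u < n \<and> u mod N \<in> ?I}"
      using dist[OF \<open>v < n\<close>] f_W N by (intro card_mono) (auto simp: f_def)
    also have "\<dots> \<le> (n div N + 1) * card ?I"
      using N by (intro card_mod_le) auto
    also have "\<dots> \<le> (n div N + 1) * card ?B"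
      using \<open>card ?I \<le> card ?B\<close> by (intro mult_left_mono) auto
    finally have "real (card {u. u < n \<and> u \<noteq> v \<and> \<not> graph_dist_eq E v u (2 ^ k - 1)})
        \<le> real ((n div N + 1) * card ?B)"
      by (rule of_nat_mono)
    also have "\<dots> = real (n div N + 1) * real (card ?B)" by (rule of_nat_mult)
    \<comment> \<open>Rounding up the class size costs at most a factor 2, as
      \<open>N \<le> n\<close>; it is paid for by the 2 in the hypothesis on
      \<open>eps * real q\<close>.\<close>
    also have "\<dots> \<le> (2 * (real n / real N)) * (eps / 2 * real N)"
    proof (intro mult_mono)
      have "real (n div N) \<le> real n / real N" by (rule of_nat_div_le_of_nat)
      then show "real (n div N + 1) \<le> 2 * (real n / real N)"
        using N by (simp add: field_simps)
      have "real (card ?B) * real q \<le> real k ^ 2 * real N"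
        using card_meeting_words[OF A(1,2,3) assms(2) q, of "f v"] f_W[of v]
        by (auto simp: W_def words_def N_def)
      also have "\<dots> \<le> (eps * real q / 2) * real N"
        using assms(4) by (intro mult_right_mono) auto
      finally show "real (card ?B) \<le> eps / 2 * real N"
        using q by (simp add: field_simps)
    qed auto
    also have "\<dots> = eps * real n" using N by simp
    finally show "real (card {u. u < n \<and> u \<noteq> v \<and> \<not> graph_dist_eq E v u (2 ^ k - 1)}) \<le> eps * real n" .
  qed
  ultimately show ?thesis by blast
qed

text \<open>The complete graph serves the range in which the required distance is at most 1.\<close>

lemma complete_distance_uniform:
  assumes "0 \<le> eps"
  shows "\<exists>E. simple_graph n E \<and> distance_uniform n E eps 1"
proof -
  define E where "E u v \<longleftrightarrow> u < n \<and> v < n \<and> u \<noteq> v" for u v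
  have "{u. u < n \<and> u \<noteq> v \<and> \<not> graph_dist_eq E v u 1} = {}" if "v < n" for v
    using that by (auto simp: graph_dist_eq_def walk_of_length_iff E_def)
  then have "distance_uniform n E eps 1"
    using assms unfolding distance_uniform_def by (metis card.empty mult_nonneg_nonneg of_nat_0 of_nat_0_le_iff)
  moreover have "simple_graph n E" by (auto simp: simple_graph_def E_def)
  ultimately show ?thesis by blast
qed

section \<open>Choice of the parameters\<close>

text \<open>With \<open>B = 1 / eps\<close> we have \<open>n = B powr R\<close>, and
  \<open>R \<le> log 2 n \<le> B\<close>. Taking \<open>k\<close> near \<open>R / 5\<close> and
  \<open>q\<close> near \<open>2 * k ^ 2 * B\<close> gives
  \<open>q \<le> 4 * B ^ 3 \<le> B ^ 5\<close>, whence \<open>q ^ k \<le> B powr R\<close>.\<close>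

lemma hanoi_parameters_exist:
  fixes n :: nat and eps R :: real
  defines "R \<equiv> ln (real n) / ln (1 / eps)"
  assumes "3 \<le> n" "0 < eps" "eps \<le> 1 / log 2 (real n)" "5 \<le> R"
  shows "\<exists>k q. 1 \<le> k \<and> R / 5 - 1 \<le> real k \<and> k \<le> q \<and> q ^ k \<le> n \<and> 2 * real k ^ 2 \<le> eps * real q"
proof -
  define B where "B = 1 / eps"
  have "log 2 (real n) > 1" using assms(2) by simp
  then have logB: "log 2 (real n) \<le> B"
    using assms(3,4) by (auto simp: B_def field_simps)
  with \<open>log 2 (real n) > 1\<close> have B1: "1 < B" by simp
  have nB: "real n = B powr R"
    using assms(2) B1 ln_gt_zero[OF B1] by (simp add: R_def powr_def flip: B_def)
  \<comment> \<open>Otherwise \<open>n = 3\<close> and \<open>B \<ge> log 2 3 \<ge> 3 / 2\<close>,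
    but then \<open>B ^ 5 > 3\<close>, contrary to \<open>5 \<le> R\<close>.\<close>
  have B2: "2 \<le> B"
  proof (rule ccontr)
    assume "\<not> 2 \<le> B"
    with logB have "log 2 (real n) < 2" by simp
    then have "real n < 2 powr 2" using assms(2) by (simp add: log_less_iff)
    then have n: "n = 3" using assms(2) by simp
    have "(2 powr (3 / 2)) ^ 2 = (2 :: real) powr 3"
      by (simp only: power2_eq_square powr_add [symmetric]) simp
    then have "(2 powr (3 / 2)) ^ 2 \<le> (3 :: real) ^ 2" by simp
    then have "2 powr (3 / 2) \<le> (3 :: real)" by (rule power2_le_imp_le) simp
    then have "3 / 2 \<le> log 2 3" by (subst le_log_iff) auto
    with logB n have "3 / 2 \<le> B" by simp
    then have "(3 / 2) ^ 5 \<le> B ^ 5" by (intro power_mono) auto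
    also have "\<dots> = B powr 5" using B1 by simp
    also have "\<dots> \<le> B powr R" using B1 assms(5) by (intro powr_mono) auto
    finally show False using nB n by (simp add: power_numeral_reduce)
  qed
  have "R = log 2 (real n) / log 2 B"
    by (simp add: R_def B_def log_def)
  also have "\<dots> \<le> log 2 (real n) / 1"
    using B2 \<open>log 2 (real n) > 1\<close> by (intro divide_left_mono) auto
  finally have RB: "R \<le> B" using logB by simp
  define k where "k = nat \<lfloor>R / 5\<rfloor>"
  define q where "q = nat \<lceil>2 * real k ^ 2 * B\<rceil>"
  have k: "1 \<le> k" "R / 5 - 1 \<le> real k" "5 * real k \<le> R"
    using assms(5) by (auto simp: k_def) linarith+
  have q: "2 * real k ^ 2 * B \<le> real q" "real q \<le> 2 * real k ^ 2 * B + 1"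
    using B1 by (auto simp: q_def)
  have "real k \<le> real k ^ 2" using k(1) by (simp add: power2_eq_square)
  also have "\<dots> \<le> 2 * real k ^ 2 * B" using mult_left_mono[of 1 "2 * B" "real k ^ 2"] B1 by simp
  finally have "k \<le> q" using q by linarith
  moreover have "q ^ k \<le> n"
  proof -
    have "real k \<le> B" using k RB by simp
    then have "2 * real k ^ 2 * B \<le> 2 * B ^ 2 * B"
      using B1 by (intro mult_right_mono mult_left_mono power_mono) auto
    with q have "real q \<le> 2 * B ^ 3 + 1" by (simp add: power_numeral_reduce)
    also have "\<dots> \<le> 4 * B ^ 3"
      using one_le_power[of B 3] B1 by linarith
    also have "\<dots> \<le> B ^ 2 * B ^ 3"
      using power_mono[of 2 B 2] B2 by (intro mult_right_mono) auto
    finally have "real q \<le> B ^ 5" by (simp flip: power_add)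
    then have "real q ^ k \<le> (B ^ 5) ^ k" by (intro power_mono) auto
    also have "\<dots> = B powr (5 * real k)" 
      using B1 powr_realpow[of B "5 * k"] by (simp add: power_mult)
    also have "\<dots> \<le> B powr R" using B1 k by (intro powr_mono) auto
    finally show ?thesis using nB by (simp flip: of_nat_power)
  qed
  moreover have "2 * real k ^ 2 \<le> eps * real q"
    using q(1) assms(3) by (simp add: B_def field_simps)
  ultimately show ?thesis using k by blast
qed

theorem theorem2:
  shows "\<exists>c>0. \<exists>c'>0. \<forall>n::nat. \<forall>eps::real.
           n \<ge> 3 \<and> 1 / real n \<le> eps \<and> eps \<le> 1 / log 2 (real n) \<longrightarrow>
           (\<exists>E d. simple_graph n E \<and> distance_uniform n E eps d \<and>
                  real d \<ge> c' * 2 powr (c * (ln (real n) / ln (1 / eps))))"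
proof -
  have "\<exists>E d. simple_graph n E \<and> distance_uniform n E eps d \<and>
      real d \<ge> 1 / 4 * 2 powr (1 / 5 * (ln (real n) / ln (1 / eps)))"
    if "n \<ge> 3" "1 / real n \<le> eps" "eps \<le> 1 / log 2 (real n)" for n :: nat and eps :: real
  proof -
    let ?R = "ln (real n) / ln (1 / eps)"
    have eps: "0 < eps" using that by (intro less_le_trans[OF _ that(2)]) auto
    show ?thesis
    proof (cases "5 \<le> ?R")
      case False
      then have "2 powr (1 / 5 * ?R) \<le> 2 powr 1" by (intro powr_mono) auto
      then have "1 / 4 * 2 powr (1 / 5 * ?R) \<le> real 1" by simp
      then show ?thesis
        using complete_distance_uniform[of eps n] eps by (meson less_imp_le)
    next
      case True
      from hanoi_parameters_exist[OF that(1) eps that(3) True] obtain k q where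
        k: "1 \<le> k" "?R / 5 - 1 \<le> real k" and kq: "k \<le> q" "q ^ k \<le> n" "2 * real k ^ 2 \<le> eps * real q"
        by auto
      \<comment> \<open>Of the factor 4, one 2 pays for rounding \<open>?R / 5\<close> down to
        \<open>k\<close>, the other for \<open>2 ^ k - 1 \<ge> 2 ^ k / 2\<close>.\<close>
      have "1 / 4 * 2 powr (1 / 5 * ?R) = 2 powr (1 / 5 * ?R - 2)"
        by (simp add: powr_diff)
      also have "\<dots> \<le> 2 powr (real k - 1)"
        using k by (intro powr_mono) auto
      also have "\<dots> = 2 ^ k / 2" by (simp add: powr_diff powr_realpow)
      also have "\<dots> \<le> real (2 ^ k - 1)"
        using power_increasing[OF k(1), of "2 :: real"] by simp
      finally show ?thesis
        using hanoi_distance_uniform[OF k(1) kq] by blast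
    qed
  qed
  then show ?thesis
    by (intro exI[of _ "1 / 5 :: real"] conjI exI[of _ "1 / 4 :: real"]) auto
qed

end
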